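(* Let $X,Y$ be Polish spaces, $\mu\in\mathcal P(X)$, $\nu\in\mathcal P(Y)$ Borel probability measures, and $c:X\times Y\to[0,+\infty]$ a lower semicontinuous function such that, for some $\mathcal K<+\infty$, $\sup_{y\in Y}\int_X c(x,y)\,d\mu(x)\le\mathcal K$ and $\sup_{x\in X}\int_Y c(x,y)\,d\nu(y)\le\mathcal K$. Then for every $\varepsilon>0$ there exists a pair $(u_\varepsilon,v_\varepsilon)\in L^1_\mu\times L^1_\nu$ maximizing $\mathcal D_\varepsilon$ over $L^1_\mu\times L^1_\nu$, and it is unique up to adding and subtracting the same constant (i.e. the maximizers are exactly the pairs $(u_\varepsilon+a,v_\varepsilon-a)$, $a\in\mathbb R$, up to a.e. equality). Moreover $(u_\varepsilon,v_\varepsilon)$ can be chosen so that $-\mathcal K\le u_\varepsilon\le \mathcal K$ and $-\mathcal K\le v_\varepsilon\le\mathcal K$ (a.e.), and $u_\varepsilon=v_\varepsilon^{c,\varepsilon}$ $\mu$-a.e., $v_\varepsilon=u_\varepsilon^{c,\varepsilon}$ $\nu$-a.e.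
   Context: For $u\in L^1_\mu$, $v\in L^1_\nu$ (real-valued integrable functions), $$\mathcal D_\varepsilon(u,v)=\int_X u\,d\mu+\int_Y v\,d\nu-\varepsilon\int_{X\times Y}e^{\frac{u(x)+v(y)-c(x,y)}{\varepsilon}}\,d(\mu\otimes\nu)(x,y)+\varepsilon\in[-\infty,+\infty),$$ with the convention $e^{-\infty}=0$. The $(c,\varepsilon)$-transforms are $$u^{c,\varepsilon}(y)=-\varepsilon\log\int_X e^{\frac{u(x)-c(x,y)}{\varepsilon}}\,d\mu(x),\qquad v^{c,\varepsilon}(x)=-\varepsilon\log\int_Y e^{\frac{v(y)-c(x,y)}{\varepsilon}}\,d\nu(y).$$ *)

theory Defs
  imports "HOL-Probability.Probability"
begin

definition lower_semicontinuous :: "('a::topological_space \<Rightarrow> ennreal) \<Rightarrow> bool" where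
  "lower_semicontinuous f \<longleftrightarrow> (\<forall>a. open {x. a < f x})"

text \<open>The exponential and the logarithm on the extended half-line, with the conventions
  \<open>exp (-\<infinity>) = 0\<close> and \<open>log 0 = -\<infinity>\<close>, \<open>log \<infinity> = \<infinity>\<close>.\<close>

definition eexp :: "ereal \<Rightarrow> ennreal" where
  "eexp t = (if t = -\<infinity> then 0 else if t = \<infinity> then \<infinity> else ennreal (exp (real_of_ereal t)))"

definition elog :: "ennreal \<Rightarrow> ereal" where
  "elog t = (if t = 0 then -\<infinity> else if t = \<infinity> then \<infinity> else ereal (ln (enn2real t)))"

text \<open>The last integral below takes values in \<open>[0, \<infinity>]\<close> and is the only possibly infinite
  term, so the value lies in \<open>[-\<infinity>, \<infinity>)\<close> and \<open>\<infinity> - \<infinity>\<close> never occurs; in the exponent,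
  only \<open>c\<close> can be infinite.\<close>

definition dual_functional ::
  "'a measure \<Rightarrow> 'b measure \<Rightarrow> ('a \<times> 'b \<Rightarrow> ennreal) \<Rightarrow> real \<Rightarrow> ('a \<Rightarrow> real) \<Rightarrow> ('b \<Rightarrow> real) \<Rightarrow> ereal" where
  "dual_functional \<mu> \<nu> c \<epsilon> u v =
     ereal (\<integral>x. u x \<partial>\<mu>) + ereal (\<integral>y. v y \<partial>\<nu>)
     - ereal \<epsilon> * enn2ereal (\<integral>\<^sup>+(x, y). eexp ((ereal (u x) + ereal (v y) - enn2ereal (c (x, y))) / ereal \<epsilon>) \<partial>(\<mu> \<Otimes>\<^sub>M \<nu>))
     + ereal \<epsilon>"

definition is_dual_maximizer ::
  "'a measure \<Rightarrow> 'b measure \<Rightarrow> ('a \<times> 'b \<Rightarrow> ennreal) \<Rightarrow> real \<Rightarrow> ('a \<Rightarrow> real) \<Rightarrow> ('b \<Rightarrow> real) \<Rightarrow> bool" where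
  "is_dual_maximizer \<mu> \<nu> c \<epsilon> u v \<longleftrightarrow>
     integrable \<mu> u \<and> integrable \<nu> v \<and>
     (\<forall>u' v'. integrable \<mu> u' \<longrightarrow> integrable \<nu> v' \<longrightarrow>
        dual_functional \<mu> \<nu> c \<epsilon> u' v' \<le> dual_functional \<mu> \<nu> c \<epsilon> u v)"

text \<open>The \<open>(c, \<epsilon>)\<close>-transforms of a function on the first and on the second factor.\<close>

definition transform_fst ::
  "'a measure \<Rightarrow> ('a \<times> 'b \<Rightarrow> ennreal) \<Rightarrow> real \<Rightarrow> ('a \<Rightarrow> real) \<Rightarrow> 'b \<Rightarrow> ereal" where
  "transform_fst \<mu> c \<epsilon> u y =
     - (ereal \<epsilon> * elog (\<integral>\<^sup>+x. eexp ((ereal (u x) - enn2ereal (c (x, y))) / ereal \<epsilon>) \<partial>\<mu>))"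

definition transform_snd ::
  "'b measure \<Rightarrow> ('a \<times> 'b \<Rightarrow> ennreal) \<Rightarrow> real \<Rightarrow> ('b \<Rightarrow> real) \<Rightarrow> 'a \<Rightarrow> ereal" where
  "transform_snd \<nu> c \<epsilon> v x =
     - (ereal \<epsilon> * elog (\<integral>\<^sup>+y. eexp ((ereal (v y) - enn2ereal (c (x, y))) / ereal \<epsilon>) \<partial>\<nu>))"

end

(* The transform of f maximizes the dual functional in the second variable: the gain over g is the
   integral of exp t - 1 - t with t = (g - transform of f) / eps. So maximizers are fixed points of the
   transforms, and with Jensen's inequality every competitor improves to a uniformly bounded pair.
   Along a maximizing sequence of bounded pairs, the square roots of the densities
   exp ((u + v - c) / eps) form a Cauchy sequence in L^2, by an exact midpoint identity; as c < \<infinity> almost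
   everywhere, a subsequence of the sums u_n(x) + v_n(y) converges almost everywhere, and freezing x
   separates the two limits. The same identity gives uniqueness. *)

theory Submission
  imports Defs
begin

text \<open>Bounds alone do not make a maximizing sequence converge almost everywhere, and a cost
  that is only semicontinuous gives the transforms no common modulus of continuity. Quantitative
  concavity takes the place of compactness: averaging two pairs of potentials turns their densities
  into the geometric mean, so the concavity defect is exactly the squared distance of the square
  roots, and that is at most the sum of the two deficits from the supremum. The cost enters the
  bounds only through its sign and its means. Jensen bounds a transform above by \<open>K\<close>
  minus the mean of the potential, while nonnegativity of the cost bounds it below by minus the
  supremum of the potential. At a maximizer the density has total mass 1, and comparison with the
  zero pair makes the sum of the two means nonnegative; shifting one mean to 0 then gives the
  constant \<open>K\<close> for both potentials.\<close>

definition gibbs_density :: "('a \<Rightarrow> 'b \<Rightarrow> real) \<Rightarrow> ('a \<Rightarrow> real) \<Rightarrow> ('b \<Rightarrow> real) \<Rightarrow> 'a \<times> 'b \<Rightarrow> real" where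
  "gibbs_density h f g = (\<lambda>(x, y). exp (f x + g y - h x y))"

text \<open>The Bochner integral of a nonintegrable density is 0, so \<open>dual_value\<close> would
  rate such a pair too high although the true functional is -infinity there. Integrability of the
  density is therefore part of the domain.\<close>

definition admissible ::
  "'a measure \<Rightarrow> 'b measure \<Rightarrow> ('a \<Rightarrow> 'b \<Rightarrow> real) \<Rightarrow> ('a \<Rightarrow> real) \<Rightarrow> ('b \<Rightarrow> real) \<Rightarrow> bool" where
  "admissible M N h f g \<longleftrightarrow>
     integrable M f \<and> integrable N g \<and> integrable (M \<Otimes>\<^sub>M N) (gibbs_density h f g)"

definition dual_value ::
  "'a measure \<Rightarrow> 'b measure \<Rightarrow> ('a \<Rightarrow> 'b \<Rightarrow> real) \<Rightarrow> ('a \<Rightarrow> real) \<Rightarrow> ('b \<Rightarrow> real) \<Rightarrow> real" where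
  "dual_value M N h f g =
     (\<integral>x. f x \<partial>M) + (\<integral>y. g y \<partial>N) - (\<integral>p. gibbs_density h f g p \<partial>(M \<Otimes>\<^sub>M N))"

text \<open>Meaningful only where the exponential is integrable. The proofs first secure this: for
  almost every \<open>y\<close> if the pair is admissible, for every \<open>y\<close> if
  \<open>f\<close> is bounded above.\<close>

definition soft_transform ::
  "'a measure \<Rightarrow> ('a \<Rightarrow> 'b \<Rightarrow> real) \<Rightarrow> ('a \<Rightarrow> real) \<Rightarrow> 'b \<Rightarrow> real" where
  "soft_transform M h f y = - ln (\<integral>x. exp (f x - h x y) \<partial>M)"

section \<open>Exponential moments and the extended exponential\<close>

text \<open>Jensen's inequality, by integrating the tangent of \<open>exp\<close> at the
  mean.\<close>

lemma (in prob_space) exp_integral_le: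
  fixes X :: "'a \<Rightarrow> real"
  assumes X: "integrable M X" and eX: "integrable M (\<lambda>x. exp (X x))"
  shows "exp (\<integral>x. X x \<partial>M) \<le> (\<integral>x. exp (X x) \<partial>M)"
proof -
  define m where "m = (\<integral>x. X x \<partial>M)"
  have "exp m * (1 + (X x - m)) \<le> exp (X x)" for x
  proof -
    have "exp m * (1 + (X x - m)) \<le> exp m * exp (X x - m)"
      by (intro mult_left_mono exp_ge_add_one_self) auto
    then show ?thesis by (simp flip: exp_add)
  qed
  then have "(\<integral>x. exp m * (1 + (X x - m)) \<partial>M) \<le> (\<integral>x. exp (X x) \<partial>M)"
    by (intro integral_mono eX) (use X in auto)
  moreover have "(\<integral>x. exp m * (1 + (X x - m)) \<partial>M) = exp m"
    using X by (simp add: m_def prob_space)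
  ultimately show ?thesis by (simp add: m_def)
qed

lemma (in prob_space) exp_integral_pos:
  fixes X :: "'a \<Rightarrow> real"
  assumes "integrable M (\<lambda>x. exp (X x))"
  shows "0 < (\<integral>x. exp (X x) \<partial>M)"
proof -
  have "(\<integral>x. exp (X x) \<partial>M) \<noteq> 0"
    using integral_nonneg_eq_0_iff_AE[OF assms] by (simp add: AE_False)
  moreover have "0 \<le> (\<integral>x. exp (X x) \<partial>M)"
    by simp
  ultimately show ?thesis by linarith
qed

text \<open>At \<open>t = \<infinity>\<close> this would fail: the left side is 0, whereas
  \<open>enn2real\<close> sends \<open>\<infinity>\<close> to 0 and makes the right side
  \<open>exp a\<close>.\<close>

lemma eexp_scaled:
  assumes "\<epsilon> > 0" "t \<noteq> \<infinity>"
  shows "eexp ((ereal (\<epsilon> * a) - enn2ereal t) / ereal \<epsilon>) = ennreal (exp (a - enn2real t / \<epsilon>))"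
proof -
  obtain r where "t = ennreal r" "0 \<le> r" using assms(2) by (cases t) auto
  then show ?thesis
    using assms(1) by (simp add: eexp_def enn2ereal_ennreal diff_divide_distrib)
qed

section \<open>The real-valued kernel and the exchange of the two factors\<close>

text \<open>Intended instance: \<open>h\<close> is the cost divided by \<open>\<epsilon>\<close>,
  made real-valued, and \<open>L\<close> is \<open>K\<close> divided by \<open>\<epsilon>\<close>.
  The mean bounds are required at every point, as the suprema in the theorem provide them, so that
  the transforms can be bounded pointwise.\<close>

locale entropic_kernel = M: prob_space M + N: prob_space N
  for M :: "'a measure" and N :: "'b measure" +
  fixes h :: "'a \<Rightarrow> 'b \<Rightarrow> real" and L :: real
  assumes h_measurable[measurable]: "case_prod h \<in> borel_measurable (M \<Otimes>\<^sub>M N)"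
    and h_nonneg: "\<And>x y. 0 \<le> h x y"
    and h_fst: "\<And>y. y \<in> space N \<Longrightarrow> integrable M (\<lambda>x. h x y) \<and> (\<integral>x. h x y \<partial>M) \<le> L"
    and h_snd: "\<And>x. x \<in> space M \<Longrightarrow> integrable N (\<lambda>y. h x y) \<and> (\<integral>y. h x y \<partial>N) \<le> L"
begin

sublocale pair_prob_space M N ..

text \<open>Lets every result about the transform in one variable be reused for the other
  one.\<close>

lemma swapped: "entropic_kernel N M (\<lambda>y x. h x y) L"
  by unfold_locales (use h_fst h_snd in \<open>auto simp: h_nonneg\<close>)

lemma h_measurable': "(\<lambda>p. h (fst p) (snd p)) \<in> borel_measurable (M \<Otimes>\<^sub>M N)"
  using h_measurable by (simp add: case_prod_unfold)

lemma L_nonneg: "0 \<le> L"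
proof -
  obtain y where "y \<in> space N" using N.not_empty by blast
  moreover have "0 \<le> (\<integral>x. h x y \<partial>M)" by (simp add: h_nonneg)
  ultimately show ?thesis using h_fst by force
qed

lemma gibbs_density_measurable[measurable]:
  assumes [measurable]: "f \<in> borel_measurable M" "g \<in> borel_measurable N"
  shows "gibbs_density h f g \<in> borel_measurable (M \<Otimes>\<^sub>M N)"
  unfolding gibbs_density_def using h_measurable' by measurable

lemma admissible_swap: "admissible N M (\<lambda>y x. h x y) g f \<longleftrightarrow> admissible M N h f g"
proof -
  have *: "gibbs_density (\<lambda>y x. h x y) g f = (\<lambda>(y, x). gibbs_density h f g (x, y))"
    by (auto simp: gibbs_density_def algebra_simps)
  have "gibbs_density h f g \<in> borel_measurable (M \<Otimes>\<^sub>M N) \<Longrightarrow>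
      integrable (M \<Otimes>\<^sub>M N) (gibbs_density h f g) = integrable (N \<Otimes>\<^sub>M M) (gibbs_density (\<lambda>y x. h x y) g f)"
    using integrable_product_swap_iff[of "gibbs_density h f g"] * by simp
  moreover have "integrable (N \<Otimes>\<^sub>M M) (gibbs_density (\<lambda>y x. h x y) g f) \<Longrightarrow> integrable M f \<Longrightarrow> integrable N g \<Longrightarrow>
     gibbs_density h f g \<in> borel_measurable (M \<Otimes>\<^sub>M N)"
    by (intro gibbs_density_measurable) auto
  ultimately show ?thesis
    unfolding admissible_def by (auto dest: borel_measurable_integrable)
qed

lemma dual_value_swap:
  assumes "f \<in> borel_measurable M" "g \<in> borel_measurable N"
  shows "dual_value N M (\<lambda>y x. h x y) g f = dual_value M N h f g"
proof -
  have *: "gibbs_density (\<lambda>y x. h x y) g f = (\<lambda>(y, x). gibbs_density h f g (x, y))"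
    by (auto simp: gibbs_density_def algebra_simps)
  show ?thesis
    using integral_product_swap[of "gibbs_density h f g"] assms * by (simp add: dual_value_def)
qed

section \<open>Bounds on the soft transform and its optimality\<close>

text \<open>Jensen converts a bound on the mean of the kernel into a pointwise bound on the
  transform, although the kernel itself may be unbounded. Of \<open>f\<close> only the mean
  enters.\<close>

lemma soft_transform_le:
  assumes f: "integrable M f" and y: "y \<in> space N" and e: "integrable M (\<lambda>x. exp (f x - h x y))"
  shows "soft_transform M h f y \<le> L - (\<integral>x. f x \<partial>M)"
proof -
  have "exp (\<integral>x. f x - h x y \<partial>M) \<le> (\<integral>x. exp (f x - h x y) \<partial>M)"
    using f e h_fst[OF y] by (intro M.exp_integral_le) auto
  then have "(\<integral>x. f x - h x y \<partial>M) \<le> ln (\<integral>x. exp (f x - h x y) \<partial>M)"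
    using M.exp_integral_pos[OF e] by (simp add: ln_ge_iff)
  then show ?thesis
    using f h_fst[OF y] by (simp add: soft_transform_def)
qed

lemma integrable_exp_bounded:
  assumes [measurable]: "f \<in> borel_measurable M" and y[measurable]: "y \<in> space N" and B: "AE x in M. f x \<le> B"
  shows "integrable M (\<lambda>x. exp (f x - h x y))"
proof (rule M.integrable_const_bound[where B = "exp B"])
  show "AE x in M. norm (exp (f x - h x y)) \<le> exp B"
    using B by eventually_elim (use h_nonneg[of _ y] in \<open>smt (verit) exp_le_cancel_iff norm_exp real_norm_def abs_exp_cancel\<close>)
qed measurable

text \<open>Here only the sign of the kernel matters: the integrand is at most
  \<open>exp B\<close>.\<close>

lemma soft_transform_ge:
  assumes f: "f \<in> borel_measurable M" and y: "y \<in> space N" and B: "AE x in M. f x \<le> B"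
  shows "- B \<le> soft_transform M h f y"
proof -
  note e = integrable_exp_bounded[OF f y B]
  have "(\<integral>x. exp (f x - h x y) \<partial>M) \<le> (\<integral>x. exp B \<partial>M)"
    using B by (intro integral_mono_AE e) (auto elim!: eventually_mono simp: add_increasing2 h_nonneg diff_le_eq)
  then have "ln (\<integral>x. exp (f x - h x y) \<partial>M) \<le> B"
    using M.exp_integral_pos[OF e] ln_mono[of _ "exp B"] by (simp add: M.prob_space)
  then show ?thesis by (simp add: soft_transform_def)
qed

lemma soft_transform_measurable[measurable]:
  assumes [measurable]: "f \<in> borel_measurable M"
  shows "soft_transform M h f \<in> borel_measurable N"
proof -
  have "(\<lambda>y. \<integral>x. exp (f x - h x y) \<partial>M) \<in> borel_measurable N"
    by (rule M.borel_measurable_lebesgue_integral) measurable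
  then show ?thesis unfolding soft_transform_def by measurable
qed

lemma soft_transform_improves:
  assumes "admissible M N h f g"
  defines "g' \<equiv> soft_transform M h f"
  shows "admissible M N h f g'"
    and "(\<integral>p. gibbs_density h f g' p \<partial>(M \<Otimes>\<^sub>M N)) = 1"
    and "dual_value M N h f g \<le> dual_value M N h f g'"
    and "AE y in N. g' y \<le> L - (\<integral>x. f x \<partial>M)"
    and "dual_value M N h f g' \<le> dual_value M N h f g \<Longrightarrow> AE y in N. g y = g' y"
proof -
  have f: "integrable M f" and g: "integrable N g"
    and e: "integrable (M \<Otimes>\<^sub>M N) (\<lambda>(x, y). exp (f x + g y - h x y))"
    using assms by (auto simp: admissible_def gibbs_density_def)
  have [measurable]: "f \<in> borel_measurable M" "g \<in> borel_measurable N"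
    using f g by auto
  have [measurable]: "g' \<in> borel_measurable N" unfolding g'_def by measurable
  define \<phi> where "\<phi> y = (\<integral>x. exp (f x + g y - h x y) \<partial>M)" for y
  have \<phi>: "integrable N \<phi>" unfolding \<phi>_def by (rule integrable_snd[OF e])
  have \<phi>_int: "(\<integral>y. \<phi> y \<partial>N) = (\<integral>p. gibbs_density h f g p \<partial>(M \<Otimes>\<^sub>M N))"
    unfolding \<phi>_def gibbs_density_def by (rule integral_snd[OF e])
  have shift: "exp (f x + t - h x y) = exp t * exp (f x - h x y)" for x y t
    by (simp flip: exp_add)
  have sec: "AE y in N. integrable M (\<lambda>x. exp (f x - h x y))"
    using AE_integrable_snd[OF e] by eventually_elim (simp add: shift)
  show le: "AE y in N. g' y \<le> L - (\<integral>x. f x \<partial>M)"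
    using sec AE_space by eventually_elim (auto simp: g'_def intro: soft_transform_le f)
  have I: "AE y in N. (\<integral>x. exp (f x - h x y) \<partial>M) = exp (- g' y)"
    using sec by eventually_elim (simp add: g'_def soft_transform_def M.exp_integral_pos)
  have \<phi>_eq: "AE y in N. \<phi> y = exp (g y - g' y)"
    using I
  proof eventually_elim
    case (elim y)
    have "\<phi> y = exp (g y) * (\<integral>x. exp (f x - h x y) \<partial>M)"
      by (simp add: \<phi>_def shift)
    then show ?case by (simp add: elim flip: exp_add)
  qed
  \<comment> \<open>This is \<open>exp t \<ge> 1 + t\<close> at \<open>t = g y - g' y\<close>.
    Jensen bounds \<open>g'\<close> only from above; this inequality supplies the integrable lower
    bound.\<close>
  have ge: "AE y in N. g y + 1 - \<phi> y \<le> g' y"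
    using \<phi>_eq by eventually_elim (use exp_ge_add_one_self in \<open>smt (verit)\<close>)
  have g': "integrable N g'"
  proof (rule Bochner_Integration.integrable_bound)
    show "integrable N (\<lambda>y. \<bar>g y + 1 - \<phi> y\<bar> + \<bar>L - (\<integral>x. f x \<partial>M)\<bar>)"
      using g \<phi> by auto
    show "AE y in N. norm (g' y) \<le> norm (\<bar>g y + 1 - \<phi> y\<bar> + \<bar>L - (\<integral>x. f x \<partial>M)\<bar>)"
      using ge le by eventually_elim auto
  qed measurable
  \<comment> \<open>Integrability of the new density is not yet known, so its mass is computed as a
    nonnegative integral; each section has mass 1 by the choice of \<open>g'\<close>.\<close>
  have "(\<integral>\<^sup>+p. ennreal (gibbs_density h f g' p) \<partial>(M \<Otimes>\<^sub>M N)) = (\<integral>\<^sup>+y. (\<integral>\<^sup>+x. ennreal (exp (f x + g' y - h x y)) \<partial>M) \<partial>N)"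
    by (subst nn_integral_snd[symmetric]) (auto simp: gibbs_density_def)
  also have "\<dots> = (\<integral>\<^sup>+y. 1 \<partial>N)"
  proof (rule nn_integral_cong_AE)
    show "AE y in N. (\<integral>\<^sup>+x. ennreal (exp (f x + g' y - h x y)) \<partial>M) = 1"
      using sec I
    proof eventually_elim
      case (elim y)
      have "integrable M (\<lambda>x. exp (f x + g' y - h x y))"
        using elim by (simp add: shift)
      then have "(\<integral>\<^sup>+x. ennreal (exp (f x + g' y - h x y)) \<partial>M) = ennreal (\<integral>x. exp (f x + g' y - h x y) \<partial>M)"
        by (intro nn_integral_eq_integral) auto
      also have "(\<integral>x. exp (f x + g' y - h x y) \<partial>M) = exp (g' y) * (\<integral>x. exp (f x - h x y) \<partial>M)"
        by (simp add: shift)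
      also have "\<dots> = 1"
        using elim by (simp flip: exp_add)
      finally show ?case by simp
    qed
  qed
  finally have nn1: "(\<integral>\<^sup>+p. ennreal (gibbs_density h f g' p) \<partial>(M \<Otimes>\<^sub>M N)) = ennreal 1"
    by (simp add: N.emeasure_space_1)
  have hb: "has_bochner_integral (M \<Otimes>\<^sub>M N) (gibbs_density h f g') 1"
    by (rule has_bochner_integral_nn_integral) (use nn1 in \<open>auto simp: gibbs_density_def\<close>)
  show one: "(\<integral>p. gibbs_density h f g' p \<partial>(M \<Otimes>\<^sub>M N)) = 1"
    using hb by (rule has_bochner_integral_integral_eq)
  show "admissible M N h f g'"
    using f g' hb by (auto simp: admissible_def integrable.simps)
  have diff: "dual_value M N h f g' - dual_value M N h f g = (\<integral>y. g' y - g y - 1 + \<phi> y \<partial>N)"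
    using g g' \<phi> \<phi>_int one by (simp add: dual_value_def N.prob_space)
  have nonneg: "AE y in N. 0 \<le> g' y - g y - 1 + \<phi> y"
    using ge by eventually_elim simp
  show "dual_value M N h f g \<le> dual_value M N h f g'"
    using integral_nonneg_AE[OF nonneg] diff by simp
  assume "dual_value M N h f g' \<le> dual_value M N h f g"
  then have "(\<integral>y. g' y - g y - 1 + \<phi> y \<partial>N) = 0"
    using integral_nonneg_AE[OF nonneg] diff by simp
  \<comment> \<open>Zero gain means equality in \<open>exp t \<ge> 1 + t\<close> almost everywhere,
    which holds only at \<open>t = 0\<close>.\<close>
  then have "AE y in N. g' y - g y - 1 + \<phi> y = 0"
    using g g' \<phi> nonneg by (subst (asm) integral_nonneg_eq_0_iff_AE) auto
  with \<phi>_eq show "AE y in N. g y = g' y"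
    by eventually_elim (use exp_minus_greater[of "g' _ - g _"] in \<open>smt (verit, best)\<close>)
qed

section \<open>Null sets in the product and bounded pairs\<close>

lemma AE_fst: "AE x in M. P x \<Longrightarrow> AE p in M \<Otimes>\<^sub>M N. P (fst p)"
proof -
  assume "AE x in M. P x"
  then obtain A where A: "A \<in> null_sets M" "{x\<in>space M. \<not> P x} \<subseteq> A"
    unfolding eventually_ae_filter by blast
  have "A \<times> space N \<in> null_sets (M \<Otimes>\<^sub>M N)"
    using A(1) by (auto simp: null_sets_def N.emeasure_pair_measure_Times)
  moreover have "{p\<in>space (M \<Otimes>\<^sub>M N). \<not> P (fst p)} \<subseteq> A \<times> space N"
    using A(2) by (auto simp: space_pair_measure)
  ultimately show ?thesis unfolding eventually_ae_filter by blast
qed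

lemma AE_snd: "AE y in N. P y \<Longrightarrow> AE p in M \<Otimes>\<^sub>M N. P (snd p)"
proof -
  assume "AE y in N. P y"
  then obtain A where A: "A \<in> null_sets N" "{y\<in>space N. \<not> P y} \<subseteq> A"
    unfolding eventually_ae_filter by blast
  have "space M \<times> A \<in> null_sets (M \<Otimes>\<^sub>M N)"
    using A(1) by (auto simp: null_sets_def N.emeasure_pair_measure_Times)
  moreover have "{p\<in>space (M \<Otimes>\<^sub>M N). \<not> P (snd p)} \<subseteq> space M \<times> A"
    using A(2) by (auto simp: space_pair_measure)
  ultimately show ?thesis unfolding eventually_ae_filter by blast
qed

lemma admissible_bounded:
  assumes [measurable]: "f \<in> borel_measurable M" "g \<in> borel_measurable N"
    and f: "AE x in M. \<bar>f x\<bar> \<le> A" and g: "AE y in N. \<bar>g y\<bar> \<le> B"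
  shows "admissible M N h f g"
  unfolding admissible_def
proof (intro conjI)
  show "integrable M f" by (rule M.integrable_const_bound[where B = A]) (use f in auto)
  show "integrable N g" by (rule N.integrable_const_bound[where B = B]) (use g in auto)
  show "integrable (M \<Otimes>\<^sub>M N) (gibbs_density h f g)"
  proof (rule P.integrable_const_bound[where B = "exp (A + B)"])
    show "AE p in M \<Otimes>\<^sub>M N. norm (gibbs_density h f g p) \<le> exp (A + B)"
      using AE_fst[OF f] AE_snd[OF g]
    proof eventually_elim
      case (elim p)
      then show ?case
        using h_nonneg[of "fst p" "snd p"] by (simp add: gibbs_density_def case_prod_unfold)
    qed
  qed measurable
qed

lemma gibbs_density_shift: "gibbs_density h (\<lambda>x. f x + a) (\<lambda>y. g y - a) = gibbs_density h f g"
  by (simp add: gibbs_density_def)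

lemma dual_value_shift:
  assumes "integrable M f" "integrable N g"
  shows "dual_value M N h (\<lambda>x. f x + a) (\<lambda>y. g y - a) = dual_value M N h f g"
  using assms by (simp add: dual_value_def gibbs_density_shift M.prob_space N.prob_space)

section \<open>Normalized pairs and quantitative concavity\<close>

text \<open>The unequal constants are those that \<open>normalized_improvement\<close> delivers. The
  class contains the zero pair and is closed under midpoints, so its supremum also bounds the
  midpoints of its members.\<close>

definition normalized :: "('a \<Rightarrow> real) \<Rightarrow> ('b \<Rightarrow> real) \<Rightarrow> bool" where
  "normalized f g \<longleftrightarrow> f \<in> borel_measurable M \<and> g \<in> borel_measurable N \<and>
     (AE x in M. \<bar>f x\<bar> \<le> L) \<and> (AE y in N. \<bar>g y\<bar> \<le> 2 * L)"

lemma normalized_admissible: "normalized f g \<Longrightarrow> admissible M N h f g"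
  by (auto simp: normalized_def intro: admissible_bounded)

text \<open>The benchmark: a pair with value below -1 is beaten by the zero pair. For the others, a
  value of at least -1 becomes a sign condition on the means once a transform has made the mass
  1.\<close>

lemma dual_value_zero_ge: "- 1 \<le> dual_value M N h (\<lambda>_. 0) (\<lambda>_. 0)"
proof -
  have "admissible M N h (\<lambda>_. 0) (\<lambda>_. 0)"
    by (rule admissible_bounded[where A = 0 and B = 0]) auto
  then have "(\<integral>p. gibbs_density h (\<lambda>_. 0) (\<lambda>_. 0) p \<partial>(M \<Otimes>\<^sub>M N)) \<le> (\<integral>p. 1 \<partial>(M \<Otimes>\<^sub>M N))"
    by (intro integral_mono) (auto simp: admissible_def gibbs_density_def h_nonneg)
  then show ?thesis by (simp add: dual_value_def P.prob_space)
qed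

text \<open>Applying the transforms three times suffices: the upper bound on the first transform bounds the
  second one from both sides, and that bounds the third one.\<close>

lemma normalized_improvement:
  assumes adm: "admissible M N h f g" and J: "- 1 \<le> dual_value M N h f g"
  shows "\<exists>f' g'. normalized f' g' \<and> dual_value M N h f g \<le> dual_value M N h f' g'"
proof -
  interpret s: entropic_kernel N M "\<lambda>y x. h x y" L by (rule swapped)
  define g1 where "g1 = soft_transform M h f"
  define f1 where "f1 = soft_transform N (\<lambda>y x. h x y) g1"
  define g2 where "g2 = soft_transform M h f1"
  define a where "a = (\<integral>y. g1 y \<partial>N)"
  note 1 = soft_transform_improves[OF adm, folded g1_def]
  have sadm: "admissible N M (\<lambda>y x. h x y) g1 f"
    using 1(1) by (simp add: admissible_swap)
  note 2 = s.soft_transform_improves[OF sadm, folded f1_def]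
  have adm2: "admissible M N h f1 g1"
    using 2(1) by (simp add: admissible_swap)
  note 3 = soft_transform_improves[OF adm2, folded g2_def]
  have [measurable]: "f \<in> borel_measurable M" "g1 \<in> borel_measurable N" "f1 \<in> borel_measurable M" "g2 \<in> borel_measurable N"
    using 1(1) 2(1) 3(1) by (auto simp: admissible_def)
  have J12: "dual_value M N h f g1 \<le> dual_value M N h f1 g1"
    using 2(3) by (simp add: dual_value_swap)
  \<comment> \<open>The density of \<open>(f, g1)\<close> has mass 1, so a value of at least -1 says
    that the means have a nonnegative sum.\<close>
  have pos: "0 \<le> (\<integral>x. f x \<partial>M) + a"
    using 1(2,3) J by (simp add: dual_value_def a_def)
  have f1_le: "AE x in M. f1 x \<le> L - a"
    using 2(4) by (simp add: a_def)
  \<comment> \<open>Replacing the mean of \<open>f\<close> by \<open>-a\<close> makes this bound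
    match \<open>f1_le\<close>: \<open>f1 + a\<close> then lies between \<open>-L\<close> and
    \<open>L\<close>.\<close>
  have "AE y in N. g1 y \<le> L + a"
    using 1(4) by eventually_elim (use pos in simp)
  then have f1_ge: "x \<in> space M \<Longrightarrow> - (L + a) \<le> f1 x" for x
    unfolding f1_def by (intro s.soft_transform_ge) auto
  have g2_ge: "y \<in> space N \<Longrightarrow> - (L - a) \<le> g2 y" for y
    unfolding g2_def by (intro soft_transform_ge f1_le) auto
  have "(\<integral>x. - (L + a) \<partial>M) \<le> (\<integral>x. f1 x \<partial>M)"
    using adm2 f1_ge by (intro integral_mono) (auto simp: admissible_def)
  then have f1_int: "- (L + a) \<le> (\<integral>x. f1 x \<partial>M)" by (simp add: M.prob_space)
  have "AE x in M. \<bar>f1 x + a\<bar> \<le> L"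
    using f1_le AE_space by eventually_elim (use f1_ge in force)
  \<comment> \<open>The upper bound is \<open>L\<close> minus the mean of \<open>f1\<close>, hence
    at most \<open>2 * L + a\<close>; this is the origin of the constant \<open>2 * L\<close>. From
    below, \<open>g2 - a\<close> is at least \<open>-L\<close>.\<close>
  moreover have "AE y in N. \<bar>g2 y - a\<bar> \<le> 2 * L"
    using 3(4) AE_space by eventually_elim (use g2_ge f1_int L_nonneg in \<open>smt (verit)\<close>)
  ultimately have "normalized (\<lambda>x. f1 x + a) (\<lambda>y. g2 y - a)"
    by (simp add: normalized_def)
  moreover have "dual_value M N h f g \<le> dual_value M N h (\<lambda>x. f1 x + a) (\<lambda>y. g2 y - a)"
    using 1(3) J12 3(1,3) by (subst dual_value_shift) (auto simp: admissible_def)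
  ultimately show ?thesis by blast
qed

text \<open>The defect in the concavity inequality is an exact \<open>L\<^sup>2\<close> distance. It yields both the
  Cauchy property of maximizing sequences and uniqueness.\<close>

lemma dual_value_midpoint:
  assumes adm: "admissible M N h f g" and adm': "admissible M N h f' g'"
  defines "d \<equiv> \<lambda>p. sqrt (gibbs_density h f g p) - sqrt (gibbs_density h f' g' p)"
    and "fm \<equiv> \<lambda>x. (f x + f' x) / 2" and "gm \<equiv> \<lambda>y. (g y + g' y) / 2"
  shows "admissible M N h fm gm"
    and "integrable (M \<Otimes>\<^sub>M N) (\<lambda>p. (d p)\<^sup>2)"
    and "2 * dual_value M N h fm gm =
      dual_value M N h f g + dual_value M N h f' g' + (\<integral>p. (d p)\<^sup>2 \<partial>(M \<Otimes>\<^sub>M N))"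
proof -
  have i: "integrable M f" "integrable M f'" "integrable N g" "integrable N g'"
    and e: "integrable (M \<Otimes>\<^sub>M N) (gibbs_density h f g)" and e': "integrable (M \<Otimes>\<^sub>M N) (gibbs_density h f' g')"
    using adm adm' by (auto simp: admissible_def)
  have [measurable]: "f \<in> borel_measurable M" "f' \<in> borel_measurable M" "g \<in> borel_measurable N" "g' \<in> borel_measurable N"
    using i by auto
  have [measurable]: "fm \<in> borel_measurable M" "gm \<in> borel_measurable N"
    by (auto simp: fm_def gm_def)
  have pos: "0 \<le> gibbs_density h f g p" for f g p
    by (simp add: gibbs_density_def case_prod_unfold)
  \<comment> \<open>Exponents are averaged, so the midpoint density is the geometric mean of the two
    densities. This is the mixed term in the square of \<open>d\<close>.\<close>
  have sq: "gibbs_density h fm gm p = sqrt (gibbs_density h f g p) * sqrt (gibbs_density h f' g' p)" for p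
  proof -
    have "(gibbs_density h fm gm p)\<^sup>2 = gibbs_density h f g p * gibbs_density h f' g' p"
      by (simp add: gibbs_density_def case_prod_unfold fm_def gm_def flip: exp_add exp_double)
         (simp add: field_simps)
    then show ?thesis
      using pos by (metis real_sqrt_mult real_sqrt_unique)
  qed
  have dd: "(d p)\<^sup>2 = gibbs_density h f g p + gibbs_density h f' g' p - 2 * gibbs_density h fm gm p" for p
    by (simp add: d_def sq power2_diff pos)
  have em: "integrable (M \<Otimes>\<^sub>M N) (gibbs_density h fm gm)"
  proof (rule Bochner_Integration.integrable_bound)
    show "integrable (M \<Otimes>\<^sub>M N) (\<lambda>p. gibbs_density h f g p + gibbs_density h f' g' p)"
      using e e' by auto
    show "AE p in M \<Otimes>\<^sub>M N. norm (gibbs_density h fm gm p) \<le> norm (gibbs_density h f g p + gibbs_density h f' g' p)"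
    proof (rule AE_I2)
      fix p
      show "norm (gibbs_density h fm gm p) \<le> norm (gibbs_density h f g p + gibbs_density h f' g' p)"
        using dd[of p] pos[of f g p] pos[of f' g' p] pos[of fm gm p] zero_le_power2[of "d p"]
        unfolding real_norm_def by linarith
    qed
  qed measurable
  then show "admissible M N h fm gm"
    using i by (auto simp: admissible_def fm_def gm_def)
  show "integrable (M \<Otimes>\<^sub>M N) (\<lambda>p. (d p)\<^sup>2)"
    unfolding dd using e e' em by auto
  show "2 * dual_value M N h fm gm =
      dual_value M N h f g + dual_value M N h f' g' + (\<integral>p. (d p)\<^sup>2 \<partial>(M \<Otimes>\<^sub>M N))"
    unfolding dd dual_value_def using e e' em i by (simp add: fm_def gm_def field_simps)
qed

lemma normalized_midpoint:
  assumes "normalized f g" "normalized f' g'"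
  shows "normalized (\<lambda>x. (f x + f' x) / 2) (\<lambda>y. (g y + g' y) / 2)"
proof -
  have "AE x in M. \<bar>(f x + f' x) / 2\<bar> \<le> L"
    using assms[unfolded normalized_def, THEN conjunct2, THEN conjunct2, THEN conjunct1]
    by eventually_elim (simp add: abs_le_iff)
  moreover have "AE y in N. \<bar>(g y + g' y) / 2\<bar> \<le> 2 * L"
    using assms[unfolded normalized_def, THEN conjunct2, THEN conjunct2, THEN conjunct2]
    by eventually_elim (simp add: abs_le_iff)
  moreover have [measurable]: "f \<in> borel_measurable M" "f' \<in> borel_measurable M"
      "g \<in> borel_measurable N" "g' \<in> borel_measurable N"
    using assms by (auto simp: normalized_def)
  ultimately show ?thesis by (simp add: normalized_def)
qed

lemma dual_value_normalized_le:
  assumes "normalized f g"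
  shows "dual_value M N h f g \<le> 3 * L"
proof -
  have i: "integrable M f" "integrable N g"
    using normalized_admissible[OF assms] by (auto simp: admissible_def)
  have "(\<integral>x. f x \<partial>M) \<le> (\<integral>x. L \<partial>M)"
    using assms i by (intro integral_mono_AE) (auto simp: normalized_def)
  moreover have "(\<integral>y. g y \<partial>N) \<le> (\<integral>y. 2 * L \<partial>N)"
    using assms i by (intro integral_mono_AE) (auto simp: normalized_def)
  moreover have "0 \<le> (\<integral>p. gibbs_density h f g p \<partial>(M \<Otimes>\<^sub>M N))"
    by (simp add: gibbs_density_def case_prod_unfold)
  ultimately show ?thesis by (simp add: dual_value_def M.prob_space N.prob_space)
qed

section \<open>Existence of a maximizer\<close>

lemma maximizing_sequence_converges:
  assumes nrm: "\<And>n. normalized (F n) (G n)"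
    and le: "\<And>f g. normalized f g \<Longrightarrow> dual_value M N h f g \<le> S"
    and lim: "(\<lambda>n. dual_value M N h (F n) (G n)) \<longlonglongrightarrow> S"
  shows "\<exists>r. strict_mono r \<and> (AE p in M \<Otimes>\<^sub>M N. convergent (\<lambda>n. F (r n) (fst p) + G (r n) (snd p)))"
proof -
  define a where "a n p = sqrt (gibbs_density h (F n) (G n) p)" for n p
  note adm = normalized_admissible[OF nrm]
  have [measurable]: "F n \<in> borel_measurable M" "G n \<in> borel_measurable N" for n
    using nrm by (auto simp: normalized_def)
  have a_exp: "a n p = exp ((F n (fst p) + G n (snd p) - h (fst p) (snd p)) / 2)" for n p
  proof -
    have "a n p = sqrt ((exp ((F n (fst p) + G n (snd p) - h (fst p) (snd p)) / 2))\<^sup>2)"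
      by (simp add: a_def gibbs_density_def case_prod_unfold flip: exp_double)
    then show ?thesis by simp
  qed
  have [measurable]: "a n \<in> borel_measurable (M \<Otimes>\<^sub>M N)" for n
    unfolding a_def by measurable
  have a_int: "integrable (M \<Otimes>\<^sub>M N) (a n)" for n
  proof (rule Bochner_Integration.integrable_bound)
    show "integrable (M \<Otimes>\<^sub>M N) (\<lambda>p. 1 + gibbs_density h (F n) (G n) p)"
      using adm by (simp add: admissible_def)
    show "AE p in M \<Otimes>\<^sub>M N. norm (a n p) \<le> norm (1 + gibbs_density h (F n) (G n) p)"
    proof (rule AE_I2)
      fix p
      have "0 \<le> gibbs_density h (F n) (G n) p"
        by (simp add: gibbs_density_def case_prod_unfold)
      then show "norm (a n p) \<le> norm (1 + gibbs_density h (F n) (G n) p)"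
        using sum_power2_ge_zero[of "a n p - 1" 0] real_sqrt_pow2[of "gibbs_density h (F n) (G n) p"]
        by (simp add: a_def power2_diff)
    qed
  qed measurable
  have sq_int: "integrable (M \<Otimes>\<^sub>M N) (\<lambda>p. (a i p - a j p)\<^sup>2)" for i j
    unfolding a_def by (rule dual_value_midpoint(2)[OF adm adm])
  \<comment> \<open>The midpoint is again normalized, so its value is at most \<open>S\<close>; the
    midpoint identity then bounds the squared distance by the two deficits.\<close>
  have sq_le: "(\<integral>p. (a i p - a j p)\<^sup>2 \<partial>(M \<Otimes>\<^sub>M N)) \<le>
      (S - dual_value M N h (F i) (G i)) + (S - dual_value M N h (F j) (G j))" for i j
    using dual_value_midpoint(3)[OF adm adm, of i j] le[OF normalized_midpoint[OF nrm nrm], of i j]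
    unfolding a_def by simp
  have cauchy: "\<exists>m. \<forall>i\<ge>m. \<forall>j\<ge>m. (\<integral>p. norm (a i p - a j p) \<partial>(M \<Otimes>\<^sub>M N)) < e" if e: "e > 0" for e
  proof -
    \<comment> \<open>With both deficits below \<open>e\<^sup>2 / 2\<close> the squared distance is
      below \<open>e\<^sup>2\<close>. The weighted inequality \<open>am_gm\<close> turns this into
      an L^1 distance below \<open>e\<close>, the form needed for extracting a subsequence.\<close>
    have "\<forall>\<^sub>F n in sequentially. S - e\<^sup>2 / 2 < dual_value M N h (F n) (G n)"
      using lim e by (intro order_tendstoD) auto
    then obtain m where m: "\<And>n. n \<ge> m \<Longrightarrow> S - e\<^sup>2 / 2 < dual_value M N h (F n) (G n)"
      by (auto simp: eventually_sequentially)
    have "(\<integral>p. norm (a i p - a j p) \<partial>(M \<Otimes>\<^sub>M N)) < e" if "i \<ge> m" "j \<ge> m" for i j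
    proof -
      have am_gm: "\<bar>t\<bar> \<le> (e + t\<^sup>2 / e) / 2" for t :: real
        using e zero_le_power2[of "\<bar>t\<bar> - e"] by (simp add: field_simps power2_eq_square)
      have "(\<integral>p. norm (a i p - a j p) \<partial>(M \<Otimes>\<^sub>M N)) \<le> (\<integral>p. (e + (a i p - a j p)\<^sup>2 / e) / 2 \<partial>(M \<Otimes>\<^sub>M N))"
        using a_int sq_int unfolding real_norm_def
        by (intro integral_mono am_gm) auto
      also have "\<dots> = (e + (\<integral>p. (a i p - a j p)\<^sup>2 \<partial>(M \<Otimes>\<^sub>M N)) / e) / 2"
        using sq_int by (simp add: P.prob_space)
      also have "\<dots> < e"
        using sq_le[of i j] m[OF that(1)] m[OF that(2)] e
        by (simp add: field_simps power2_eq_square)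
      finally show ?thesis .
    qed
    then show ?thesis by blast
  qed
  obtain r where r: "strict_mono r" and C: "AE p in M \<Otimes>\<^sub>M N. Cauchy (\<lambda>n. a (r n) p)"
    using cauchy_L1_AE_cauchy_subseq[OF a_int cauchy] by blast
  have "AE x in M. \<forall>n. \<bar>F n x\<bar> \<le> L" "AE y in N. \<forall>n. \<bar>G n y\<bar> \<le> 2 * L"
    using nrm by (auto simp: AE_all_countable normalized_def)
  note bounds = AE_fst[OF this(1)] AE_snd[OF this(2)]
  have "AE p in M \<Otimes>\<^sub>M N. convergent (\<lambda>n. F (r n) (fst p) + G (r n) (snd p))"
    using C bounds
  proof eventually_elim
    case (elim p)
    obtain l where l: "(\<lambda>n. a (r n) p) \<longlonglongrightarrow> l"
      using elim(1) by (auto simp: Cauchy_convergent_iff convergent_def)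
    \<comment> \<open>The uniform bounds \<open>L\<close> and \<open>2 * L\<close> keep the square
      roots away from 0 at each fixed point, so the logarithm can be applied to the limit.\<close>
    have "exp ((- (3 * L) - h (fst p) (snd p)) / 2) \<le> a n p" for n
      using elim(2)[rule_format, of n] elim(3)[rule_format, of n] by (simp add: a_exp abs_le_iff)
    then have "exp ((- (3 * L) - h (fst p) (snd p)) / 2) \<le> l"
      by (intro LIMSEQ_le_const[OF l]) auto
    then have "l \<noteq> 0" using exp_gt_zero by (metis not_le)
    then have "(\<lambda>n. 2 * ln (a (r n) p) + h (fst p) (snd p)) \<longlonglongrightarrow> 2 * ln l + h (fst p) (snd p)"
      by (intro tendsto_intros l)
    moreover have "2 * ln (a (r n) p) + h (fst p) (snd p) = F (r n) (fst p) + G (r n) (snd p)" for n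
      by (simp add: a_exp field_simps)
    ultimately show ?case by (auto simp: convergent_def)
  qed
  with r show ?thesis by blast
qed

text \<open>The supremum is taken over normalized pairs only, where the bounds permit dominated
  convergence. The improvement lemma shows at the end that no admissible pair exceeds it.\<close>

lemma exists_maximizer:
  "\<exists>f g. admissible M N h f g \<and>
     (\<forall>f' g'. admissible M N h f' g' \<longrightarrow> dual_value M N h f' g' \<le> dual_value M N h f g)"
proof -
  define V where "V = {dual_value M N h f g | f g. normalized f g}"
  define S where "S = Sup V"
  have zero: "normalized (\<lambda>_. 0) (\<lambda>_. 0)" using L_nonneg by (simp add: normalized_def)
  have ne: "V \<noteq> {}" using zero by (auto simp: V_def)
  have bdd: "bdd_above V"
    using dual_value_normalized_le by (auto simp: V_def intro!: bdd_aboveI)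
  have le_S: "dual_value M N h f g \<le> S" if "normalized f g" for f g
    unfolding S_def using that bdd by (intro cSup_upper) (auto simp: V_def)
  have "\<exists>f g. normalized f g \<and> S - 1 / real (Suc n) < dual_value M N h f g" for n
  proof -
    have "\<exists>v\<in>V. S - 1 / real (Suc n) < v"
      using less_cSup_iff[OF ne bdd, of "S - 1 / real (Suc n)"] by (simp add: S_def)
    then show ?thesis by (auto simp: V_def)
  qed
  then obtain F G where nrm: "\<And>n. normalized (F n) (G n)"
    and FG: "\<And>n. S - 1 / real (Suc n) < dual_value M N h (F n) (G n)"
    by metis
  have lim: "(\<lambda>n. dual_value M N h (F n) (G n)) \<longlonglongrightarrow> S"
  proof (rule tendsto_sandwich[OF _ _ _ tendsto_const])
    have "(\<lambda>n. S - 1 / real (Suc n)) \<longlonglongrightarrow> S - 0"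
      by (intro tendsto_diff tendsto_const LIMSEQ_inverse_real_of_nat[unfolded inverse_eq_divide])
    then show "(\<lambda>n. S - 1 / real (Suc n)) \<longlonglongrightarrow> S" by simp
  qed (use FG le_S[OF nrm] in \<open>auto intro!: always_eventually less_imp_le\<close>)
  obtain r where r: "strict_mono r"
    and conv: "AE p in M \<Otimes>\<^sub>M N. convergent (\<lambda>n. F (r n) (fst p) + G (r n) (snd p))"
    using maximizing_sequence_converges[OF nrm le_S lim] by blast
  have [measurable]: "F n \<in> borel_measurable M" "G n \<in> borel_measurable N" for n
    using nrm by (auto simp: normalized_def)
  have Fb: "AE x in M. \<forall>n. \<bar>F n x\<bar> \<le> L" and Gb: "AE y in N. \<forall>n. \<bar>G n y\<bar> \<le> 2 * L"
    using nrm by (auto simp: AE_all_countable normalized_def)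
  have conv2: "AE x in M. AE y in N. convergent (\<lambda>n. F (r n) x + G (r n) y)"
    using AE_pair[OF conv] by simp
  then have "AE x in M. (\<forall>n. \<bar>F n x\<bar> \<le> L) \<and> (AE y in N. convergent (\<lambda>n. F (r n) x + G (r n) y))"
    using Fb by eventually_elim simp
  then obtain x0 where x0: "\<And>n. \<bar>F n x0\<bar> \<le> L"
    and G_conv: "AE y in N. convergent (\<lambda>n. F (r n) x0 + G (r n) y)"
    using eventually_happens'[OF M.ae_filter_bot] by blast
  define F' where "F' n x = F (r n) x + (- F (r n) x0)" for n x
  define G' where "G' n y = G (r n) y - (- F (r n) x0)" for n y
  have [measurable]: "F' n \<in> borel_measurable M" "G' n \<in> borel_measurable N" for n
    unfolding F'_def G'_def by measurable
  define f where "f x = lim (\<lambda>n. F' n x)" for x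
  define g where "g y = lim (\<lambda>n. G' n y)" for y
  have [measurable]: "f \<in> borel_measurable M" "g \<in> borel_measurable N"
    unfolding f_def g_def by measurable
  have g: "AE y in N. (\<lambda>n. G' n y) \<longlonglongrightarrow> g y"
    using G_conv by eventually_elim (simp add: g_def G'_def add.commute convergent_LIMSEQ_iff)
  have f: "AE x in M. (\<lambda>n. F' n x) \<longlonglongrightarrow> f x"
    using conv2
  proof eventually_elim
    case (elim x)
    \<comment> \<open>Subtracting the convergent \<open>G'\<close> from the convergent sums isolates
      \<open>F'\<close>. The conclusion does not depend on \<open>y\<close>, so one good
      \<open>y\<close> suffices, and \<open>N\<close> is not the zero measure.\<close>
    then have "AE y in N. convergent (\<lambda>n. F' n x)"
      using g
    proof eventually_elim
      case (elim y)
      show ?case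
        using convergent_diff[OF elim(1) convergentI[OF elim(2)]] by (simp add: F'_def G'_def)
    qed
    then have "convergent (\<lambda>n. F' n x)" by simp
    then show ?case by (simp add: f_def convergent_LIMSEQ_iff)
  qed
  have F'b: "AE x in M. \<forall>n. \<bar>F' n x\<bar> \<le> 2 * L"
    using Fb
  proof eventually_elim
    case (elim x)
    show ?case
    proof
      fix n
      show "\<bar>F' n x\<bar> \<le> 2 * L"
        using elim[rule_format, of "r n"] x0[of "r n"] unfolding F'_def by linarith
    qed
  qed
  have G'b: "AE y in N. \<forall>n. \<bar>G' n y\<bar> \<le> 3 * L"
    using Gb
  proof eventually_elim
    case (elim y)
    show ?case
    proof
      fix n
      show "\<bar>G' n y\<bar> \<le> 3 * L"
        using elim[rule_format, of "r n"] x0[of "r n"] unfolding G'_def by linarith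
    qed
  qed
  have f': "AE x in M. norm (F' n x) \<le> 2 * L" for n
    using F'b by eventually_elim simp
  have g': "AE y in N. norm (G' n y) \<le> 3 * L" for n
    using G'b by eventually_elim simp
  have "AE p in M \<Otimes>\<^sub>M N. (\<lambda>n. F' n (fst p)) \<longlonglongrightarrow> f (fst p)"
       "AE p in M \<Otimes>\<^sub>M N. (\<lambda>n. G' n (snd p)) \<longlonglongrightarrow> g (snd p)"
    by (rule AE_fst[OF f] AE_snd[OF g])+
  then have e: "AE p in M \<Otimes>\<^sub>M N. (\<lambda>n. gibbs_density h (F' n) (G' n) p) \<longlonglongrightarrow> gibbs_density h f g p"
    by eventually_elim (auto simp: gibbs_density_def case_prod_unfold intro!: tendsto_intros)
  have e': "AE p in M \<Otimes>\<^sub>M N. norm (gibbs_density h (F' n) (G' n) p) \<le> exp (5 * L)" for n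
    using AE_fst[OF F'b] AE_snd[OF G'b]
  proof eventually_elim
    case (elim p)
    have "F' n (fst p) + G' n (snd p) - h (fst p) (snd p) \<le> 5 * L"
      using h_nonneg[of "fst p" "snd p"] elim(1)[rule_format, of n] elim(2)[rule_format, of n]
      by linarith
    then show ?case by (simp add: gibbs_density_def case_prod_unfold)
  qed
  have "integrable M f" and lim_f: "(\<lambda>n. \<integral>x. F' n x \<partial>M) \<longlonglongrightarrow> (\<integral>x. f x \<partial>M)"
    by (rule integrable_dominated_convergence[OF _ _ _ f f'] integral_dominated_convergence[OF _ _ _ f f'];
        simp)+
  moreover have "integrable N g" and lim_g: "(\<lambda>n. \<integral>y. G' n y \<partial>N) \<longlonglongrightarrow> (\<integral>y. g y \<partial>N)"
    by (rule integrable_dominated_convergence[OF _ _ _ g g'] integral_dominated_convergence[OF _ _ _ g g'];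
        simp)+
  moreover have "integrable (M \<Otimes>\<^sub>M N) (gibbs_density h f g)"
    and lim_e: "(\<lambda>n. \<integral>p. gibbs_density h (F' n) (G' n) p \<partial>(M \<Otimes>\<^sub>M N)) \<longlonglongrightarrow> (\<integral>p. gibbs_density h f g p \<partial>(M \<Otimes>\<^sub>M N))"
    by (rule integrable_dominated_convergence[OF _ _ _ e e'] integral_dominated_convergence[OF _ _ _ e e'];
        simp)+
  ultimately have adm: "admissible M N h f g" by (simp add: admissible_def)
  have "(\<lambda>n. dual_value M N h (F' n) (G' n)) \<longlonglongrightarrow> dual_value M N h f g"
    unfolding dual_value_def by (intro tendsto_add tendsto_diff lim_f lim_g lim_e)
  moreover have "dual_value M N h (F' n) (G' n) = dual_value M N h (F (r n)) (G (r n))" for n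
    unfolding F'_def G'_def
    using normalized_admissible[OF nrm] by (intro dual_value_shift) (auto simp: admissible_def)
  ultimately have "(\<lambda>n. dual_value M N h (F (r n)) (G (r n))) \<longlonglongrightarrow> dual_value M N h f g"
    by simp
  then have val: "dual_value M N h f g = S"
    using LIMSEQ_subseq_LIMSEQ[OF lim r] by (auto intro: LIMSEQ_unique simp: o_def)
  \<comment> \<open>The improvement lemma needs a value of at least -1; below that level the zero
    pair gives the comparison.\<close>
  have "dual_value M N h f' g' \<le> S" if "admissible M N h f' g'" for f' g'
  proof (cases "- 1 \<le> dual_value M N h f' g'")
    case True
    then show ?thesis using normalized_improvement[OF that] le_S by force
  next
    case False
    then show ?thesis using dual_value_zero_ge le_S[OF zero] by linarith
  qed
  with adm val show ?thesis by blast
qed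

section \<open>Uniqueness, fixed point equations and the sharp bounds\<close>

text \<open>The midpoint cannot beat a maximum, so the two densities agree almost everywhere. Since
  \<open>h\<close> is finite, the sums of the potentials agree, and a sum of functions of separate
  variables determines its summands up to a constant.\<close>

lemma maximizer_unique:
  assumes adm: "admissible M N h f g" and adm': "admissible M N h f' g'"
    and max: "\<forall>u v. admissible M N h u v \<longrightarrow> dual_value M N h u v \<le> dual_value M N h f g"
    and eq: "dual_value M N h f g \<le> dual_value M N h f' g'"
  shows "\<exists>a. (AE x in M. f' x = f x + a) \<and> (AE y in N. g' y = g y - a)"
proof -
  note mid = dual_value_midpoint[OF adm adm']
  have "(\<integral>p. (sqrt (gibbs_density h f g p) - sqrt (gibbs_density h f' g' p))\<^sup>2 \<partial>(M \<Otimes>\<^sub>M N)) \<le> 0"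
    using mid(3) max[rule_format, OF mid(1)] eq by linarith
  then have "(\<integral>p. (sqrt (gibbs_density h f g p) - sqrt (gibbs_density h f' g' p))\<^sup>2 \<partial>(M \<Otimes>\<^sub>M N)) = 0"
    by (intro antisym) simp_all
  then have "AE p in M \<Otimes>\<^sub>M N. (sqrt (gibbs_density h f g p) - sqrt (gibbs_density h f' g' p))\<^sup>2 = 0"
    using mid(2) by (subst (asm) integral_nonneg_eq_0_iff_AE) auto
  then have "AE p in M \<Otimes>\<^sub>M N. f (fst p) + g (snd p) = f' (fst p) + g' (snd p)"
    by eventually_elim (simp add: gibbs_density_def case_prod_unfold)
  then have *: "AE x in M. AE y in N. f x + g y = f' x + g' y"
    using AE_pair by fastforce
  then obtain x0 where x0: "AE y in N. f x0 + g y = f' x0 + g' y"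
    using eventually_happens'[OF M.ae_filter_bot] by blast
  define a where "a = f' x0 - f x0"
  have g: "AE y in N. g' y = g y - a"
    using x0 by eventually_elim (simp add: a_def)
  have "AE x in M. f' x = f x + a"
    using *
  proof eventually_elim
    case (elim x)
    then have "AE y in N. f' x = f x + a"
      using g by eventually_elim simp
    then show ?case by simp
  qed
  with g show ?thesis by blast
qed

text \<open>The converse half of uniqueness. Equality almost everywhere need not preserve
  measurability, so integrability of the new pair is assumed.\<close>

lemma dual_value_shift_AE:
  assumes adm: "admissible M N h f g" and i: "integrable M f'" "integrable N g'"
    and f': "AE x in M. f' x = f x + a" and g': "AE y in N. g' y = g y - a"
  shows "admissible M N h f' g' \<and> dual_value M N h f' g' = dual_value M N h f g"
proof -
  have ig: "integrable M f" "integrable N g" "integrable (M \<Otimes>\<^sub>M N) (gibbs_density h f g)"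
    using adm by (auto simp: admissible_def)
  have [measurable]: "f \<in> borel_measurable M" "f' \<in> borel_measurable M"
     "g \<in> borel_measurable N" "g' \<in> borel_measurable N"
    using ig i by auto
  have e: "AE p in M \<Otimes>\<^sub>M N. gibbs_density h f' g' p = gibbs_density h f g p"
    using AE_fst[OF f'] AE_snd[OF g'] by eventually_elim (simp add: gibbs_density_def case_prod_unfold)
  have "integrable (M \<Otimes>\<^sub>M N) (gibbs_density h f' g')"
    using ig(3) e by (subst integrable_cong_AE[OF _ _ e]) auto
  moreover have "(\<integral>p. gibbs_density h f' g' p \<partial>(M \<Otimes>\<^sub>M N)) = (\<integral>p. gibbs_density h f g p \<partial>(M \<Otimes>\<^sub>M N))"
    by (rule integral_cong_AE[OF _ _ e]) auto
  moreover have "(\<integral>x. f' x \<partial>M) = (\<integral>x. f x + a \<partial>M)" "(\<integral>y. g' y \<partial>N) = (\<integral>y. g y - a \<partial>N)"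
    by (rule integral_cong_AE[OF _ _ f'] integral_cong_AE[OF _ _ g']; measurable)+
  ultimately show ?thesis
    using i ig by (simp add: admissible_def dual_value_def M.prob_space N.prob_space)
qed

text \<open>The third claim combines the mass 1 of the optimal density with the benchmark value -1
  of the zero pair. It turns the Jensen bound for one potential into a bound for the other.\<close>

lemma maximizer_fixed_point:
  assumes adm: "admissible M N h f g"
    and max: "\<forall>u v. admissible M N h u v \<longrightarrow> dual_value M N h u v \<le> dual_value M N h f g"
  shows "AE y in N. g y = soft_transform M h f y"
    and "AE y in N. g y \<le> L - (\<integral>x. f x \<partial>M)"
    and "0 \<le> (\<integral>x. f x \<partial>M) + (\<integral>y. g y \<partial>N)"
proof -
  note T = soft_transform_improves[OF adm]
  have le: "dual_value M N h f (soft_transform M h f) \<le> dual_value M N h f g"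
    using max T(1) by blast
  then show g: "AE y in N. g y = soft_transform M h f y"
    by (rule T(5))
  show "AE y in N. g y \<le> L - (\<integral>x. f x \<partial>M)"
    using g T(4) by eventually_elim simp
  have [measurable]: "g \<in> borel_measurable N" "f \<in> borel_measurable M"
    using adm by (auto simp: admissible_def)
  have "(\<integral>y. g y \<partial>N) = (\<integral>y. soft_transform M h f y \<partial>N)"
    by (rule integral_cong_AE[OF _ _ g]) measurable
  moreover have "admissible M N h (\<lambda>_. 0) (\<lambda>_. 0)"
    by (rule admissible_bounded[where A = 0 and B = 0]) auto
  then have "dual_value M N h (\<lambda>_. 0) (\<lambda>_. 0) \<le> dual_value M N h f g"
    using max by blast
  then have "- 1 \<le> dual_value M N h f (soft_transform M h f)"
    using dual_value_zero_ge T(3) by linarith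
  ultimately show "0 \<le> (\<integral>x. f x \<partial>M) + (\<integral>y. g y \<partial>N)"
    using T(2) unfolding dual_value_def by linarith
qed

text \<open>At a maximizer both fixed point equations hold at once. With the mean of
  \<open>f\<close> shifted to 0, the mean of \<open>g\<close> is nonnegative, so both Jensen bounds
  reduce to \<open>L\<close>, improving on the \<open>2 * L\<close> of normalized pairs.\<close>

theorem exists_bounded_maximizer:
  "\<exists>f g. admissible M N h f g \<and>
     (\<forall>u v. admissible M N h u v \<longrightarrow> dual_value M N h u v \<le> dual_value M N h f g) \<and>
     (AE x in M. \<bar>f x\<bar> \<le> L) \<and> (AE y in N. \<bar>g y\<bar> \<le> L) \<and>
     (AE x in M. f x = soft_transform N (\<lambda>y x. h x y) g x) \<and>
     (AE y in N. g y = soft_transform M h f y)"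
proof -
  interpret s: entropic_kernel N M "\<lambda>y x. h x y" L by (rule swapped)
  obtain f0 g0 where adm0: "admissible M N h f0 g0"
    and max0: "\<And>u v. admissible M N h u v \<Longrightarrow> dual_value M N h u v \<le> dual_value M N h f0 g0"
    using exists_maximizer by blast
  have i0: "integrable M f0" "integrable N g0"
    using adm0 by (auto simp: admissible_def)
  define a where "a = - (\<integral>x. f0 x \<partial>M)"
  define f where "f = (\<lambda>x. f0 x + a)"
  define g where "g = (\<lambda>y. g0 y - a)"
  have i: "integrable M f" "integrable N g"
    using i0 by (auto simp: f_def g_def)
  have shift: "admissible M N h f g \<and> dual_value M N h f g = dual_value M N h f0 g0"
    by (rule dual_value_shift_AE[OF adm0 i, of a]) (auto simp: f_def g_def)
  then have adm: "admissible M N h f g" by simp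
  have max: "\<forall>u v. admissible M N h u v \<longrightarrow> dual_value M N h u v \<le> dual_value M N h f g"
    using max0 shift by simp
  have sadm: "admissible N M (\<lambda>y x. h x y) g f"
    using adm by (simp add: admissible_swap)
  have smax: "\<forall>v u. admissible N M (\<lambda>y x. h x y) v u \<longrightarrow>
    dual_value N M (\<lambda>y x. h x y) v u \<le> dual_value N M (\<lambda>y x. h x y) g f"
  proof (intro allI impI)
    fix u v
    assume "admissible N M (\<lambda>y x. h x y) v u"
    then have uv: "admissible M N h u v" by (simp add: admissible_swap)
    then have "u \<in> borel_measurable M" "v \<in> borel_measurable N"
      by (auto simp: admissible_def)
    then show "dual_value N M (\<lambda>y x. h x y) v u \<le> dual_value N M (\<lambda>y x. h x y) g f"
      using max uv i by (simp add: dual_value_swap)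
  qed
  note fp = maximizer_fixed_point[OF adm max]
  note sfp = s.maximizer_fixed_point[OF sadm smax]
  have f_int: "(\<integral>x. f x \<partial>M) = 0"
    using i0 by (simp add: f_def a_def M.prob_space)
  then have g_int: "0 \<le> (\<integral>y. g y \<partial>N)" using fp(3) by simp
  have g_le: "AE y in N. g y \<le> L" using fp(2) f_int by simp
  have f_le: "AE x in M. f x \<le> L"
    using sfp(2) by eventually_elim (use g_int in simp)
  \<comment> \<open>Each potential is the transform of the other, so an upper bound on one is a
    lower bound on the other with the sign reversed.\<close>
  have g_ge: "AE y in N. - L \<le> g y"
    using fp(1) AE_space
    by eventually_elim (use i in \<open>auto intro!: soft_transform_ge f_le\<close>)
  have f_ge: "AE x in M. - L \<le> f x"
    using sfp(1) AE_space
    by eventually_elim (use i in \<open>auto intro!: s.soft_transform_ge g_le\<close>)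
  have "AE x in M. \<bar>f x\<bar> \<le> L" using f_le f_ge by eventually_elim simp
  moreover have "AE y in N. \<bar>g y\<bar> \<le> L" using g_le g_ge by eventually_elim simp
  ultimately show ?thesis using adm max fp(1) sfp(1) by blast
qed

section \<open>Return to the extended-valued cost\<close>

text \<open>In terms of \<open>h = c / \<epsilon>\<close>, \<open>f = u / \<epsilon>\<close> and \<open>g = v / \<epsilon>\<close> the parameter \<open>\<epsilon>\<close> disappears.\<close>

lemma dual_functional_eq:
  assumes \<epsilon>: "\<epsilon> > 0" and h: "h = (\<lambda>x y. enn2real (c (x, y)) / \<epsilon>)"
    and fin: "AE p in M \<Otimes>\<^sub>M N. c p \<noteq> \<infinity>"
    and f: "integrable M f" and g: "integrable N g"
  shows "dual_functional M N c \<epsilon> (\<lambda>x. \<epsilon> * f x) (\<lambda>y. \<epsilon> * g y) =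
    (if admissible M N h f g then ereal (\<epsilon> * (dual_value M N h f g + 1)) else - \<infinity>)"
proof -
  have [measurable]: "f \<in> borel_measurable M" "g \<in> borel_measurable N"
    using f g by auto
  have nonneg: "0 \<le> gibbs_density h f g p" for p
    by (simp add: gibbs_density_def case_prod_unfold)
  have "AE p in M \<Otimes>\<^sub>M N. eexp ((ereal (\<epsilon> * f (fst p)) + ereal (\<epsilon> * g (snd p)) - enn2ereal (c p)) / ereal \<epsilon>)
      = ennreal (gibbs_density h f g p)"
    using fin
  proof eventually_elim
    case (elim p)
    then show ?case
      using eexp_scaled[OF \<epsilon>, of "c p" "f (fst p) + g (snd p)"]
      by (simp add: gibbs_density_def h case_prod_unfold distrib_left)
  qed
  then have nn: "(\<integral>\<^sup>+(x, y). eexp ((ereal (\<epsilon> * f x) + ereal (\<epsilon> * g y) - enn2ereal (c (x, y))) / ereal \<epsilon>) \<partial>(M \<Otimes>\<^sub>M N))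
      = (\<integral>\<^sup>+p. ennreal (gibbs_density h f g p) \<partial>(M \<Otimes>\<^sub>M N))"
    unfolding case_prod_unfold by (intro nn_integral_cong_AE) simp
  show ?thesis
  proof (cases "admissible M N h f g")
    case True
    then have "integrable (M \<Otimes>\<^sub>M N) (gibbs_density h f g)" by (simp add: admissible_def)
    then have "(\<integral>\<^sup>+p. ennreal (gibbs_density h f g p) \<partial>(M \<Otimes>\<^sub>M N)) = ennreal (\<integral>p. gibbs_density h f g p \<partial>(M \<Otimes>\<^sub>M N))"
      using nonneg by (intro nn_integral_eq_integral) auto
    then have "enn2ereal (\<integral>\<^sup>+p. ennreal (gibbs_density h f g p) \<partial>(M \<Otimes>\<^sub>M N)) = ereal (\<integral>p. gibbs_density h f g p \<partial>(M \<Otimes>\<^sub>M N))"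
      by (simp add: enn2ereal_ennreal nonneg)
    then show ?thesis
      unfolding dual_functional_def nn using True by (simp add: dual_value_def algebra_simps)
  next
    case False
    then have "\<not> integrable (M \<Otimes>\<^sub>M N) (gibbs_density h f g)"
      using f g by (simp add: admissible_def)
    then have "(\<integral>\<^sup>+p. ennreal (gibbs_density h f g p) \<partial>(M \<Otimes>\<^sub>M N)) = \<infinity>"
      using nonneg by (simp add: integrable_iff_bounded not_less top_unique)
    then show ?thesis
      unfolding dual_functional_def nn using False \<epsilon> by simp
  qed
qed

text \<open>Inadmissible pairs have value -infinity, while the zero pair has a finite one. Hence a
  maximizer among all integrable pairs is admissible, and enlarging the competition changes
  nothing.\<close>

lemma is_dual_maximizer_iff:
  assumes \<epsilon>: "\<epsilon> > 0" and h: "h = (\<lambda>x y. enn2real (c (x, y)) / \<epsilon>)"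
    and fin: "AE p in M \<Otimes>\<^sub>M N. c p \<noteq> \<infinity>"
  shows "is_dual_maximizer M N c \<epsilon> (\<lambda>x. \<epsilon> * f x) (\<lambda>y. \<epsilon> * g y) \<longleftrightarrow>
    admissible M N h f g \<and>
    (\<forall>f' g'. admissible M N h f' g' \<longrightarrow> dual_value M N h f' g' \<le> dual_value M N h f g)"
    (is "?max \<longleftrightarrow> ?adm \<and> ?le")
proof
  note D = dual_functional_eq[OF \<epsilon> h fin]
  assume max: ?max
  then have i: "integrable M f" "integrable N g"
    using \<epsilon> by (auto simp: is_dual_maximizer_def)
  have le: "dual_functional M N c \<epsilon> (\<lambda>x. \<epsilon> * f' x) (\<lambda>y. \<epsilon> * g' y) \<le>
      dual_functional M N c \<epsilon> (\<lambda>x. \<epsilon> * f x) (\<lambda>y. \<epsilon> * g y)"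
    if "integrable M f'" "integrable N g'" for f' g'
    using max that by (simp add: is_dual_maximizer_def)
  have "admissible M N h (\<lambda>_. 0) (\<lambda>_. 0)"
    by (rule admissible_bounded[where A = 0 and B = 0]) auto
  then have adm: ?adm
    using le[of "\<lambda>_. 0" "\<lambda>_. 0"] D[of "\<lambda>_. 0" "\<lambda>_. 0"] D[OF i] by (auto split: if_splits)
  moreover have ?le
  proof (intro allI impI)
    fix f' g' assume adm': "admissible M N h f' g'"
    then have i': "integrable M f'" "integrable N g'" by (auto simp: admissible_def)
    show "dual_value M N h f' g' \<le> dual_value M N h f g"
      using le[OF i'] \<epsilon> by (simp add: D[OF i] D[OF i'] adm adm')
  qed
  ultimately show "?adm \<and> ?le" by blast
next
  note D = dual_functional_eq[OF \<epsilon> h fin]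
  assume *: "?adm \<and> ?le"
  then have i: "integrable M f" "integrable N g" by (auto simp: admissible_def)
  have "dual_functional M N c \<epsilon> u v \<le> dual_functional M N c \<epsilon> (\<lambda>x. \<epsilon> * f x) (\<lambda>y. \<epsilon> * g y)"
    if "integrable M u" "integrable N v" for u v
    using D[of "\<lambda>x. u x / \<epsilon>" "\<lambda>y. v y / \<epsilon>"] D[OF i] that * \<epsilon> by simp
  then show ?max using i by (simp add: is_dual_maximizer_def)
qed

lemma transform_fst_eq:
  assumes \<epsilon>: "\<epsilon> > 0" and h: "h = (\<lambda>x y. enn2real (c (x, y)) / \<epsilon>)"
    and fin: "AE x in M. c (x, y) \<noteq> \<infinity>"
    and int: "integrable M (\<lambda>x. exp (f x - h x y))"
  shows "transform_fst M c \<epsilon> (\<lambda>x. \<epsilon> * f x) y = ereal (\<epsilon> * soft_transform M h f y)"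
proof -
  have "AE x in M. eexp ((ereal (\<epsilon> * f x) - enn2ereal (c (x, y))) / ereal \<epsilon>) = ennreal (exp (f x - h x y))"
    using fin by eventually_elim (simp add: eexp_scaled[OF \<epsilon>] h)
  then have "(\<integral>\<^sup>+x. eexp ((ereal (\<epsilon> * f x) - enn2ereal (c (x, y))) / ereal \<epsilon>) \<partial>M)
      = (\<integral>\<^sup>+x. ennreal (exp (f x - h x y)) \<partial>M)"
    by (rule nn_integral_cong_AE)
  also have "\<dots> = ennreal (\<integral>x. exp (f x - h x y) \<partial>M)"
    using int by (intro nn_integral_eq_integral) auto
  finally show ?thesis
    using M.exp_integral_pos[OF int]
    by (simp add: transform_fst_def soft_transform_def elog_def)
qed

end

lemma integrable_enn2real:
  assumes [measurable]: "f \<in> borel_measurable M" and le: "(\<integral>\<^sup>+x. f x \<partial>M) \<le> K" and K: "K < \<infinity>"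
  shows "AE x in M. f x \<noteq> \<infinity>" "integrable M (\<lambda>x. enn2real (f x))"
    "(\<integral>x. enn2real (f x) \<partial>M) \<le> enn2real K"
proof -
  have fin: "(\<integral>\<^sup>+x. f x \<partial>M) < \<infinity>" using le K by (rule le_less_trans)
  then show ae: "AE x in M. f x \<noteq> \<infinity>" by (intro nn_integral_PInf_AE) auto
  have eq: "(\<integral>\<^sup>+x. ennreal (enn2real (f x)) \<partial>M) = (\<integral>\<^sup>+x. f x \<partial>M)"
    using ae by (intro nn_integral_cong_AE) (auto simp: less_top)
  then show "integrable M (\<lambda>x. enn2real (f x))"
    using fin by (intro integrableI_nonneg) auto
  have "(\<integral>x. enn2real (f x) \<partial>M) = enn2real (\<integral>\<^sup>+x. f x \<partial>M)"
    by (subst integral_eq_nn_integral) (auto simp: eq)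
  then show "(\<integral>x. enn2real (f x) \<partial>M) \<le> enn2real K"
    using le K by (simp add: enn2real_mono)
qed

lemma borel_measurable_lower_semicontinuous:
  "lower_semicontinuous f \<Longrightarrow> f \<in> borel_measurable borel"
  by (rule borel_measurableI_greater) (auto simp: lower_semicontinuous_def)

theorem theorem2p10:
  fixes \<mu> :: "'a::polish_space measure" and \<nu> :: "'b::polish_space measure"
    and c :: "'a \<times> 'b \<Rightarrow> ennreal" and K :: ennreal and \<epsilon> :: real
  assumes "prob_space \<mu>" and "sets \<mu> = sets borel"
    and "prob_space \<nu>" and "sets \<nu> = sets borel"
    and "lower_semicontinuous c"
    and "K < \<infinity>"
    and "(SUP y. \<integral>\<^sup>+x. c (x, y) \<partial>\<mu>) \<le> K"
    and "(SUP x. \<integral>\<^sup>+y. c (x, y) \<partial>\<nu>) \<le> K"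
    and "\<epsilon> > 0"
  shows "\<exists>u v. is_dual_maximizer \<mu> \<nu> c \<epsilon> u v
    \<and> (\<forall>u' v'. integrable \<mu> u' \<longrightarrow> integrable \<nu> v' \<longrightarrow>
         (is_dual_maximizer \<mu> \<nu> c \<epsilon> u' v' \<longleftrightarrow>
            (\<exists>a::real. (AE x in \<mu>. u' x = u x + a) \<and> (AE y in \<nu>. v' y = v y - a))))
    \<and> (AE x in \<mu>. - enn2real K \<le> u x \<and> u x \<le> enn2real K)
    \<and> (AE y in \<nu>. - enn2real K \<le> v y \<and> v y \<le> enn2real K)
    \<and> (AE x in \<mu>. ereal (u x) = transform_snd \<nu> c \<epsilon> v x)
    \<and> (AE y in \<nu>. ereal (v y) = transform_fst \<mu> c \<epsilon> u y)"
proof -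
  interpret \<mu>: prob_space \<mu> by fact
  interpret \<nu>: prob_space \<nu> by fact
  note [measurable_cong] = \<open>sets \<mu> = sets borel\<close> \<open>sets \<nu> = sets borel\<close>
  have space: "space \<mu> = UNIV" "space \<nu> = UNIV"
    using sets_eq_imp_space_eq[OF \<open>sets \<mu> = sets borel\<close>] sets_eq_imp_space_eq[OF \<open>sets \<nu> = sets borel\<close>]
    by simp_all
  have "sets (\<mu> \<Otimes>\<^sub>M \<nu>) = sets borel"
    using sets_pair_measure_cong[OF \<open>sets \<mu> = sets borel\<close> \<open>sets \<nu> = sets borel\<close>] unfolding borel_prod .
  then have c_meas[measurable]: "c \<in> borel_measurable (\<mu> \<Otimes>\<^sub>M \<nu>)"
    using borel_measurable_lower_semicontinuous[OF \<open>lower_semicontinuous c\<close>]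
    by (simp cong: measurable_cong_sets)
  have sec1[measurable]: "(\<lambda>x. c (x, y)) \<in> borel_measurable \<mu>" for y
    by (rule measurable_compose[OF _ c_meas]) (simp add: space)
  have sec2[measurable]: "(\<lambda>y. c (x, y)) \<in> borel_measurable \<nu>" for x
    by (rule measurable_compose[OF _ c_meas]) (simp add: space)
  have le1: "(\<integral>\<^sup>+x. c (x, y) \<partial>\<mu>) \<le> K" for y
    using \<open>(SUP y. \<integral>\<^sup>+x. c (x, y) \<partial>\<mu>) \<le> K\<close> by (simp add: SUP_le_iff)
  have le2: "(\<integral>\<^sup>+y. c (x, y) \<partial>\<nu>) \<le> K" for x
    using \<open>(SUP x. \<integral>\<^sup>+y. c (x, y) \<partial>\<nu>) \<le> K\<close> by (simp add: SUP_le_iff)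
  note c1 = integrable_enn2real[OF sec1 le1 \<open>K < \<infinity>\<close>]
  note c2 = integrable_enn2real[OF sec2 le2 \<open>K < \<infinity>\<close>]
  \<comment> \<open>\<open>enn2real\<close> replaces an infinite cost by 0. The mean bounds make the
    cost finite almost everywhere on every section, so neither the functional nor the transforms
    change.\<close>
  define h where "h = (\<lambda>x y. enn2real (c (x, y)) / \<epsilon>)"
  define L where "L = enn2real K / \<epsilon>"
  have \<epsilon>: "\<epsilon> > 0" by fact
  have h_meas: "case_prod h \<in> borel_measurable (\<mu> \<Otimes>\<^sub>M \<nu>)"
    unfolding h_def by measurable
  interpret E: entropic_kernel \<mu> \<nu> h L
    by unfold_locales (use h_meas c1(2,3) c2(2,3) \<epsilon> in \<open>auto simp: h_def L_def divide_right_mono\<close>)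
  interpret S: entropic_kernel \<nu> \<mu> "\<lambda>y x. h x y" L
    by (rule E.swapped)
  have fin: "AE p in \<mu> \<Otimes>\<^sub>M \<nu>. c p \<noteq> \<infinity>"
    by (rule E.AE_pair_measure) (use c2(1) in auto)
  note max_iff = E.is_dual_maximizer_iff[OF \<epsilon> h_def fin]
  obtain f g where adm: "admissible \<mu> \<nu> h f g"
    and max: "\<forall>u v. admissible \<mu> \<nu> h u v \<longrightarrow> dual_value \<mu> \<nu> h u v \<le> dual_value \<mu> \<nu> h f g"
    and f_bound: "AE x in \<mu>. \<bar>f x\<bar> \<le> L" and g_bound: "AE y in \<nu>. \<bar>g y\<bar> \<le> L"
    and f_eq: "AE x in \<mu>. f x = soft_transform \<nu> (\<lambda>y x. h x y) g x"
    and g_eq: "AE y in \<nu>. g y = soft_transform \<mu> h f y"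
    using E.exists_bounded_maximizer by blast
  have i: "f \<in> borel_measurable \<mu>" "g \<in> borel_measurable \<nu>"
    using adm by (auto simp: admissible_def)
  have f_le: "AE x in \<mu>. f x \<le> L" and g_le: "AE y in \<nu>. g y \<le> L"
    using f_bound g_bound by auto
  define u where "u = (\<lambda>x. \<epsilon> * f x)"
  define v where "v = (\<lambda>y. \<epsilon> * g y)"
  have maximizer: "is_dual_maximizer \<mu> \<nu> c \<epsilon> u v"
    unfolding u_def v_def max_iff using adm max by blast
  have unique: "is_dual_maximizer \<mu> \<nu> c \<epsilon> u' v' \<longleftrightarrow>
      (\<exists>a. (AE x in \<mu>. u' x = u x + a) \<and> (AE y in \<nu>. v' y = v y - a))"
    if "integrable \<mu> u'" "integrable \<nu> v'" for u' v'
  proof -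
    define f' where "f' = (\<lambda>x. u' x / \<epsilon>)"
    define g' where "g' = (\<lambda>y. v' y / \<epsilon>)"
    have u'v': "u' = (\<lambda>x. \<epsilon> * f' x)" "v' = (\<lambda>y. \<epsilon> * g' y)"
      using \<epsilon> by (auto simp: f'_def g'_def)
    have i': "integrable \<mu> f'" "integrable \<nu> g'"
      using that by (auto simp: f'_def g'_def)
    have "is_dual_maximizer \<mu> \<nu> c \<epsilon> u' v' \<longleftrightarrow>
        (\<exists>a. (AE x in \<mu>. f' x = f x + a) \<and> (AE y in \<nu>. g' y = g y - a))"
      (is "_ \<longleftrightarrow> ?R")
    proof
      assume "is_dual_maximizer \<mu> \<nu> c \<epsilon> u' v'"
      then have "admissible \<mu> \<nu> h f' g'" "dual_value \<mu> \<nu> h f g \<le> dual_value \<mu> \<nu> h f' g'"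
        using adm unfolding u'v' max_iff by auto
      then show ?R by (rule E.maximizer_unique[OF adm _ max])
    next
      assume ?R
      then obtain a where "AE x in \<mu>. f' x = f x + a" "AE y in \<nu>. g' y = g y - a" by blast
      then have "admissible \<mu> \<nu> h f' g' \<and> dual_value \<mu> \<nu> h f' g' = dual_value \<mu> \<nu> h f g"
        by (rule E.dual_value_shift_AE[OF adm i'])
      then show "is_dual_maximizer \<mu> \<nu> c \<epsilon> u' v'"
        unfolding u'v' max_iff using max by auto
    qed
    \<comment> \<open>A shift by \<open>a\<close> of the rescaled potentials is a shift by
      \<open>\<epsilon> * a\<close> of the original ones, and this runs through all reals with
      \<open>a\<close>.\<close>
    also have "\<dots> \<longleftrightarrow> (\<exists>a. (AE x in \<mu>. u' x = u x + \<epsilon> * a) \<and> (AE y in \<nu>. v' y = v y - \<epsilon> * a))"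
      using \<epsilon> by (simp add: u_def v_def u'v' flip: distrib_left right_diff_distrib)
    also have "\<dots> \<longleftrightarrow> (\<exists>a. (AE x in \<mu>. u' x = u x + a) \<and> (AE y in \<nu>. v' y = v y - a))"
    proof
      assume "\<exists>a. (AE x in \<mu>. u' x = u x + a) \<and> (AE y in \<nu>. v' y = v y - a)"
      then obtain a where "AE x in \<mu>. u' x = u x + a" "AE y in \<nu>. v' y = v y - a" by blast
      then show "\<exists>a. (AE x in \<mu>. u' x = u x + \<epsilon> * a) \<and> (AE y in \<nu>. v' y = v y - \<epsilon> * a)"
        using \<epsilon> by (intro exI[of _ "a / \<epsilon>"]) simp
    qed blast
    finally show ?thesis .
  qed
  have scale: "- enn2real K \<le> \<epsilon> * t \<and> \<epsilon> * t \<le> enn2real K" if "\<bar>t\<bar> \<le> L" for t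
    using that \<epsilon> by (auto simp: L_def abs_le_iff field_simps)
  have u_bound: "AE x in \<mu>. - enn2real K \<le> u x \<and> u x \<le> enn2real K"
    using f_bound unfolding u_def by eventually_elim (rule scale)
  have v_bound: "AE y in \<nu>. - enn2real K \<le> v y \<and> v y \<le> enn2real K"
    using g_bound unfolding v_def by eventually_elim (rule scale)
  have v_eq: "AE y in \<nu>. ereal (v y) = transform_fst \<mu> c \<epsilon> u y"
    using g_eq
  proof eventually_elim
    case (elim y)
    have "integrable \<mu> (\<lambda>x. exp (f x - h x y))"
      by (rule E.integrable_exp_bounded[OF i(1) _ f_le]) (simp add: space)
    then show ?case
      using E.transform_fst_eq[OF \<epsilon> h_def c1(1)] elim by (simp add: u_def v_def)
  qed
  have u_eq: "AE x in \<mu>. ereal (u x) = transform_snd \<nu> c \<epsilon> v x"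
    using f_eq
  proof eventually_elim
    case (elim x)
    have "integrable \<nu> (\<lambda>y. exp (g y - h x y))"
      by (rule S.integrable_exp_bounded[OF i(2) _ g_le]) (simp add: space)
    \<comment> \<open>Exchanging the arguments of the cost makes this the first transform in the
      swapped kernel.\<close>
    moreover have "transform_snd \<nu> c \<epsilon> v x = transform_fst \<nu> (\<lambda>(y, x). c (x, y)) \<epsilon> v x"
      by (simp add: transform_snd_def transform_fst_def)
    ultimately show ?case
      using S.transform_fst_eq[OF \<epsilon>, of "\<lambda>(y, x). c (x, y)" x g] c2(1)[of x] elim
      by (simp add: u_def v_def h_def)
  qed
  show ?thesis
    by (intro exI[of _ u] exI[of _ v] conjI allI impI maximizer unique u_bound v_bound u_eq v_eq)
qed

end
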